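(* The following are equivalent: (i) two independent rooted Bernoulli percolations $(A,0)$ and $(B,0)$ on $\mathbb{N}$ are rooted rough isometric with positive probability; (ii) there exist some $p>0$ and constants $(M,D,R)$ such that, given two independent rooted Bernoulli percolations $(A,0)$ and $(B,0)$ on $\mathbb{N}$, for any $n\ge1$, $A(n)$ is rooted rough isometric to some initial segment of $B$ with constants $(M,D,R)$ with probability at least $p$.
   Context: A rooted Bernoulli percolation on $\mathbb{N}=\{1,2,\ldots\}$ is a random subset $A\subseteq\mathbb{N}\cup\{0\}$ in which $0\in A$ deterministically and each $n\in\mathbb{N}$ belongs to $A$ with probability $\frac12$, independently. For an infinite $A\subseteq\mathbb{N}\cup\{0\}$, $A(n)\subseteq A$ denotes the set of its first (smallest) $n$ points. Subsets of $\mathbb{R}$ are viewed as metric spaces with the metric inherited from $\mathbb{R}$. Two rooted metric spaces $(X,a)$ and $(Y,b)$ are rooted rough isometric with constants $(M,D,R)$ ($M>0$, $D,R\ge 0$) if there is a mapping $T:X\to Y$ with $T(a)=b$ such that: (i) for all $x_1,x_2\in X$, $\frac1M d_X(x_1,x_2)-D\le d_Y(T(x_1),T(x_2))\le M d_X(x_1,x_2)+D$; (ii) for every $y\in Y$ there is $x\in X$ with $d_Y(y,T(x))\le R$. They are rooted rough isometric if this holds for some constants $(M,D,R)$. For infinite $A,B\subseteq\mathbb{N}\cup\{0\}$ both containing $0$, "$A(n)$ is rooted rough isometric to some initial segment of $B$ with constants $(M,D,R)$" means that there exists $m\ge1$ (which may depend on $A$, $B$, $n$) such that $(A(n),0)$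 and $(B(m),0)$ are rooted rough isometric, by a map $T:A(n)\to B(m)$, with constants $(M,D,R)$. *)

theory Defs
  imports "HOL-Probability.Probability" "HOL-Library.Infinite_Set"
begin

text \<open>
  Rooted metric spaces are represented as a subset of a type of class \<open>metric_space\<close> together
  with a point of that subset. Random subsets of the nonnegative integers take values in
  \<^typ>\<open>nat set\<close>; as metric spaces they are the subsets \<open>real ` A\<close> of the real line.
\<close>

definition rooted_rough_isometry ::
    "real \<Rightarrow> real \<Rightarrow> real \<Rightarrow> 'a::metric_space set \<Rightarrow> 'a \<Rightarrow> 'b::metric_space set \<Rightarrow> 'b \<Rightarrow> ('a \<Rightarrow> 'b) \<Rightarrow> bool"
  where
  "rooted_rough_isometry M D R X a Y b T \<longleftrightarrow>
     T ` X \<subseteq> Y \<and> T a = b \<and>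
     (\<forall>x1\<in>X. \<forall>x2\<in>X. 1 / M * dist x1 x2 - D \<le> dist (T x1) (T x2) \<and>
                      dist (T x1) (T x2) \<le> M * dist x1 x2 + D) \<and>
     (\<forall>y\<in>Y. \<exists>x\<in>X. dist y (T x) \<le> R)"

definition rooted_rough_isometric_with ::
    "real \<Rightarrow> real \<Rightarrow> real \<Rightarrow> 'a::metric_space set \<Rightarrow> 'a \<Rightarrow> 'b::metric_space set \<Rightarrow> 'b \<Rightarrow> bool"
  where
  "rooted_rough_isometric_with M D R X a Y b \<longleftrightarrow> (\<exists>T. rooted_rough_isometry M D R X a Y b T)"

definition rooted_rough_isometric ::
    "'a::metric_space set \<Rightarrow> 'a \<Rightarrow> 'b::metric_space set \<Rightarrow> 'b \<Rightarrow> bool"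
  where
  "rooted_rough_isometric X a Y b \<longleftrightarrow>
     (\<exists>M>0. \<exists>D\<ge>0. \<exists>R\<ge>0. rooted_rough_isometric_with M D R X a Y b)"

text \<open>
  The first \<open>n\<close> points of an infinite set; for finite sets, which a percolation produces only
  with probability zero, the value is irrelevant.
\<close>

definition initial_segment :: "nat set \<Rightarrow> nat \<Rightarrow> nat set"
  where "initial_segment A n = enumerate A ` {..<n}"

definition rooted_bernoulli_percolation :: "'w measure \<Rightarrow> ('w \<Rightarrow> nat set) \<Rightarrow> bool"
  where
  "rooted_bernoulli_percolation P A \<longleftrightarrow>
     prob_space P \<and>
     (\<forall>\<omega>\<in>space P. 0 \<in> A \<omega>) \<and>
     prob_space.indep_vars P (\<lambda>_. count_space UNIV) (\<lambda>n \<omega>. n \<in> A \<omega>) {1..} \<and>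
     (\<forall>n\<ge>1. measure P {\<omega> \<in> space P. n \<in> A \<omega>} = 1 / 2)"

text \<open>
  Random sets are independent if their membership indicators, as random elements of the product
  space of truth values over \<^typ>\<open>nat\<close>, are independent.
\<close>

definition indep_random_sets :: "'w measure \<Rightarrow> ('w \<Rightarrow> nat set) \<Rightarrow> ('w \<Rightarrow> nat set) \<Rightarrow> bool"
  where
  "indep_random_sets P A B \<longleftrightarrow>
     prob_space.indep_var P
       (\<Pi>\<^sub>M n\<in>UNIV. count_space UNIV) (\<lambda>\<omega> n. n \<in> A \<omega>)
       (\<Pi>\<^sub>M n\<in>UNIV. count_space UNIV) (\<lambda>\<omega> n. n \<in> B \<omega>)"

end

theory Submission
  imports Defs "HOL-Library.Diagonal_Subsequence"
begin

text \<open>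
  All constants may be taken equal to one natural number \<open>c\<close>. By compactness, a rough isometry
  from \<open>A\<close> to \<open>B\<close> exists iff for every \<open>N\<close> there is a map with the required properties on
  \<open>A \<inter> {..N}\<close>. These are decreasing events depending on finitely many sites, and the \<open>N\<close>-th one
  is implied by a rough isometry from \<open>A(N + 1)\<close> to an initial segment of \<open>B\<close>, so uniform lower
  bounds on the probabilities pass to the limit.

  Conversely, restrict a rough isometry \<open>T\<close> to \<open>A(n)\<close> and take as target the points of \<open>B\<close> up to
  \<open>Max (T ` A(n))\<close>. This can fail to be a rough isometry only if \<open>T\<close> returns below this maximum
  far beyond the last point \<open>s\<close> of \<open>A(n)\<close>. To leave it for good, \<open>T\<close> then has to cross a gap of
  \<open>A\<close> which begins at some \<open>s + d\<close> with \<open>d\<close> large and has length at least \<open>d / c\<^sup>2 - 3\<close>. Since gap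
  lengths are geometrically distributed, the probability of this is small uniformly in \<open>n\<close>.
\<close>

section \<open>Rough isometries between sets of natural numbers\<close>

lemma rooted_rough_isometric_with_mono:
  assumes "rooted_rough_isometric_with M D R X a Y b"
    and "0 < M" "M \<le> M'" "D \<le> D'" "R \<le> R'"
  shows "rooted_rough_isometric_with M' D' R' X a Y b"
proof -
  have lower: "1 / M' * d \<le> 1 / M * d" and upper: "M * d \<le> M' * d" if "0 \<le> d" for d :: real
    using assms that by (auto intro!: mult_right_mono divide_left_mono)
  have "1 / M' * dist x1 x2 - D' \<le> u \<and> u \<le> M' * dist x1 x2 + D'"
    if "1 / M * dist x1 x2 - D \<le> u" "u \<le> M * dist x1 x2 + D" for x1 x2 :: 'a and u
    using that assms lower[of "dist x1 x2"] upper[of "dist x1 x2"] by auto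
  moreover obtain T where "rooted_rough_isometry M D R X a Y b T"
    using assms(1) by (auto simp: rooted_rough_isometric_with_def)
  ultimately have "rooted_rough_isometry M' D' R' X a Y b T"
    using \<open>R \<le> R'\<close> unfolding rooted_rough_isometry_def by (meson order_trans)
  then show ?thesis
    by (auto simp: rooted_rough_isometric_with_def)
qed

text \<open>Any natural number above \<open>M\<close>, \<open>D\<close> and \<open>R\<close> works.
  Since \<open>c\<close> does not depend on the spaces, it serves all outcomes and all segments at
  once, and the constants now range over a countable set.\<close>

lemma rooted_rough_isometric_nat_constant:
  assumes "0 < M"
  obtains c :: nat where "1 \<le> c"
    "\<And>X a Y b. rooted_rough_isometric_with M D R X a Y b \<Longrightarrow> rooted_rough_isometric_with c c c X a Y b"
proof -
  define c where "c = nat \<lceil>max M (max D R)\<rceil>"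
  have c: "M \<le> c" "D \<le> c" "R \<le> c"
    unfolding c_def by linarith+
  with assms have "1 \<le> c"
    by linarith
  with c assms show thesis
    by (intro that[of c]) (auto intro: rooted_rough_isometric_with_mono)
qed

text \<open>Condition (i) with both constants equal to \<open>c\<close>. The lower bound is
  multiplied by \<open>c\<close>, which removes the division and is an equivalent form for
  \<open>c\<close> at least 1.\<close>

definition bounded_distortion :: "nat \<Rightarrow> nat set \<Rightarrow> (nat \<Rightarrow> nat) \<Rightarrow> bool" where
  "bounded_distortion c X T \<longleftrightarrow> (\<forall>x1\<in>X. \<forall>x2\<in>X.
     \<bar>real x1 - real x2\<bar> \<le> c * (\<bar>real (T x1) - real (T x2)\<bar> + c) \<and>
     \<bar>real (T x1) - real (T x2)\<bar> \<le> c * \<bar>real x1 - real x2\<bar> + c)"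

lemma bounded_distortionD:
  assumes "bounded_distortion c X T" "x1 \<in> X" "x2 \<in> X"
  shows "\<bar>real x1 - real x2\<bar> \<le> c * (\<bar>real (T x1) - real (T x2)\<bar> + c)"
    and "\<bar>real (T x1) - real (T x2)\<bar> \<le> c * \<bar>real x1 - real x2\<bar> + c"
  using assms by (auto simp: bounded_distortion_def)

lemma bounded_distortion_subset:
  "bounded_distortion c X T \<Longrightarrow> X' \<subseteq> X \<Longrightarrow> bounded_distortion c X' T"
  unfolding bounded_distortion_def by blast

lemma bounded_distortion_cong:
  "(\<And>x. x \<in> X \<Longrightarrow> T x = T' x) \<Longrightarrow> bounded_distortion c X T = bounded_distortion c X T'"
  unfolding bounded_distortion_def by simp

text \<open>A map into \<open>real\<close> Y\<open>has natural values on\<close>real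
  \<open>X\<close>, so taking floors loses nothing. The density constant \<open>e\<close> is kept
  apart from \<open>c\<close> because cutting a map down to an initial segment enlarges this
  constant only.\<close>

lemma rooted_rough_isometric_with_nat_iff:
  assumes "0 \<in> X" "1 \<le> c"
  shows "rooted_rough_isometric_with c c e (real ` X) 0 (real ` Y) 0 \<longleftrightarrow>
    (\<exists>T :: nat \<Rightarrow> nat. T ` X \<subseteq> Y \<and> T 0 = 0 \<and> bounded_distortion c X T \<and>
      (\<forall>y\<in>Y. \<exists>x\<in>X. \<bar>real y - real (T x)\<bar> \<le> e))" (is "?L \<longleftrightarrow> ?R")
proof -
  have lower: "1 / c * u - c \<le> v \<longleftrightarrow> u \<le> c * (v + c)" for u v :: real
    using assms by (simp add: field_simps)
  show ?thesis
  proof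
    assume ?L
    then obtain T where T: "rooted_rough_isometry c c e (real ` X) 0 (real ` Y) 0 T"
      by (auto simp: rooted_rough_isometric_with_def)
    define T' where "T' x = nat \<lfloor>T (real x)\<rfloor>" for x
    have real_T': "real (T' x) = T (real x)" if "x \<in> X" for x
      using T that by (force simp: rooted_rough_isometry_def T'_def)
    have "T' x \<in> Y" if "x \<in> X" for x
    proof -
      have "T (real x) \<in> real ` Y"
        using T that by (auto simp: rooted_rough_isometry_def)
      then show ?thesis
        using real_T'[OF that] by (metis imageE of_nat_eq_iff)
    qed
    moreover have "T' 0 = 0"
      using T by (simp add: rooted_rough_isometry_def T'_def)
    moreover have "bounded_distortion c X T'"
      using T unfolding rooted_rough_isometry_def lower
      by (simp add: bounded_distortion_def real_T' dist_real_def)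
    moreover have "\<forall>y\<in>Y. \<exists>x\<in>X. \<bar>real y - real (T' x)\<bar> \<le> e"
      using T by (force simp: rooted_rough_isometry_def real_T' dist_real_def)
    ultimately show ?R
      by blast
  next
    assume ?R
    then obtain T where T: "T ` X \<subseteq> Y" "T 0 = 0" "bounded_distortion c X T"
      "\<forall>y\<in>Y. \<exists>x\<in>X. \<bar>real y - real (T x)\<bar> \<le> e" by blast
    have "rooted_rough_isometry c c e (real ` X) 0 (real ` Y) 0 (\<lambda>x. real (T (nat \<lfloor>x\<rfloor>)))"
      using T unfolding rooted_rough_isometry_def lower
      by (auto simp: bounded_distortion_def dist_real_def)
    then show ?L
      by (auto simp: rooted_rough_isometric_with_def)
  qed
qed

section \<open>Conditions on finite windows\<close>

text \<open>
  The points \<open>y\<close> with \<open>c (y + 2 c) \<le> N\<close> are those for which bounded distortion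
  forces every \<open>x\<close> with \<open>\<bar>y - T x\<bar> \<le> c\<close> to satisfy \<open>x \<le> N\<close>. With this range of \<open>y\<close> the
  condition is monotone in \<open>N\<close>.
\<close>

definition partial_rough_isometry ::
    "nat \<Rightarrow> nat \<Rightarrow> nat set \<Rightarrow> nat set \<Rightarrow> (nat \<Rightarrow> nat) \<Rightarrow> bool" where
  "partial_rough_isometry c N A B T \<longleftrightarrow>
     T 0 = 0 \<and> T ` (A \<inter> {..N}) \<subseteq> B \<and> bounded_distortion c (A \<inter> {..N}) T \<and>
     (\<forall>y\<in>B. c * (y + 2 * c) \<le> N \<longrightarrow> (\<exists>x\<in>A \<inter> {..N}. \<bar>real y - real (T x)\<bar> \<le> c))"

lemma near_preimage_le:
  assumes "bounded_distortion c X T" "0 \<in> X" "T 0 = 0" "x \<in> X" "\<bar>real y - real (T x)\<bar> \<le> c"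
  shows "x \<le> c * (y + 2 * c)"
proof -
  have "real x \<le> c * (real (T x) + c)"
    using bounded_distortionD(1)[OF assms(1,4,2)] assms(3) by simp
  also have "\<dots> \<le> c * (real y + 2 * c)"
    using assms(5) by (intro mult_left_mono) auto
  also have "\<dots> = real (c * (y + 2 * c))"
    by simp
  finally show ?thesis
    by linarith
qed

text \<open>Restriction could only lose witnesses \<open>x\<close> beyond \<open>N\<close>, but by
  \<open>near_preimage_le\<close> a witness for a \<open>y\<close> that still counts lies in
  \<open>{..N}\<close>.\<close>

lemma partial_rough_isometry_antimono:
  assumes "partial_rough_isometry c N' A B T" "N \<le> N'" "0 \<in> A"
  shows "partial_rough_isometry c N A B T"
proof -
  have sub: "A \<inter> {..N} \<subseteq> A \<inter> {..N'}"
    using assms(2) by auto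
  have "\<exists>x\<in>A \<inter> {..N}. \<bar>real y - real (T x)\<bar> \<le> c" if y: "y \<in> B" "c * (y + 2 * c) \<le> N" for y
  proof -
    have "c * (y + 2 * c) \<le> N'"
      using y assms(2) by linarith
    then obtain x where x: "x \<in> A \<inter> {..N'}" "\<bar>real y - real (T x)\<bar> \<le> c"
      using assms(1) y(1) unfolding partial_rough_isometry_def by blast
    have "x \<le> c * (y + 2 * c)"
      using assms x by (intro near_preimage_le[of c "A \<inter> {..N'}" T])
        (auto simp: partial_rough_isometry_def)
    then show ?thesis
      using x y(2) by (intro bexI[of _ x]) auto
  qed
  then show ?thesis
    using assms(1) sub bounded_distortion_subset[OF _ sub]
    unfolding partial_rough_isometry_def by blast
qed

lemma partial_rough_isometry_cong:
  assumes "0 \<in> A" "\<And>x. x \<in> A \<Longrightarrow> x \<le> N \<Longrightarrow> T x = T' x"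
  shows "partial_rough_isometry c N A B T \<longleftrightarrow> partial_rough_isometry c N A B T'"
proof -
  have "bounded_distortion c (A \<inter> {..N}) T = bounded_distortion c (A \<inter> {..N}) T'"
    using assms by (intro bounded_distortion_cong) auto
  moreover have "T ` (A \<inter> {..N}) = T' ` (A \<inter> {..N})"
    using assms by (intro image_cong) auto
  moreover have "T 0 = T' 0"
    using assms by simp
  moreover have "(\<exists>x\<in>A \<inter> {..N}. \<bar>real y - real (T x)\<bar> \<le> c) \<longleftrightarrow>
      (\<exists>x\<in>A \<inter> {..N}. \<bar>real y - real (T' x)\<bar> \<le> c)" for y
    using assms by (intro bex_cong) auto
  ultimately show ?thesis
    by (simp add: partial_rough_isometry_def)
qed

lemma bounded_distortion_le:
  assumes "bounded_distortion c X T" "0 \<in> X" "T 0 = 0" "x \<in> X"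
  shows "T x \<le> c * x + c"
proof -
  have "real (T x) \<le> real (c * x + c)"
    using bounded_distortionD(2)[OF assms(1,4,2)] assms(3) by simp
  then show ?thesis
    by linarith
qed

text \<open>Points up to \<open>N\<close> have images at most \<open>c * N + c\<close>, and each
  \<open>y\<close> subject to the density condition is at most \<open>N\<close>. So finitely many
  sites of both sets decide the condition.\<close>

lemma partial_rough_isometry_local:
  assumes "partial_rough_isometry c N A B T" "0 \<in> A" "1 \<le> c"
    and "A \<inter> {..N} = A' \<inter> {..N}" "B \<inter> {..c * N + c} = B' \<inter> {..c * N + c}"
  shows "partial_rough_isometry c N A' B' T"
proof -
  have T: "T 0 = 0" "bounded_distortion c (A \<inter> {..N}) T" "T ` (A \<inter> {..N}) \<subseteq> B"
    using assms(1) by (auto simp: partial_rough_isometry_def)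
  have "T x \<in> B'" if "x \<in> A \<inter> {..N}" for x
  proof -
    have "T x \<le> c * x + c"
      using T that assms(2) by (intro bounded_distortion_le[of c "A \<inter> {..N}"]) auto
    also have "\<dots> \<le> c * N + c"
      using that by simp
    finally show ?thesis
      using T(3) that assms(5) by blast
  qed
  moreover have "y \<in> B" if "y \<in> B'" "c * (y + 2 * c) \<le> N" for y
  proof -
    have "y \<le> c * (y + 2 * c)"
      using assms(3) by (cases c) auto
    also have "\<dots> \<le> N" by fact
    also have "\<dots> \<le> c * N + c"
      using assms(3) by (cases c) auto
    finally show ?thesis
      using that(1) assms(5) by blast
  qed
  ultimately show ?thesis
    using assms(1) unfolding partial_rough_isometry_def assms(4)[symmetric] by blast
qed

section \<open>Compactness\<close>

text \<open>At each \<open>x\<close> only finitely many values occur, so one of them recurs along a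
  subsequence; the diagonal sequence handles all \<open>x\<close> together.\<close>

lemma pointwise_bounded_convergent_subsequence:
  fixes f :: "nat \<Rightarrow> nat \<Rightarrow> nat" and b :: "nat \<Rightarrow> nat"
  assumes "\<And>k x. f k x \<le> b x"
  obtains r T where "strict_mono (r :: nat \<Rightarrow> nat)" "\<And>x. \<forall>\<^sub>F k in sequentially. f (r k) x = T x"
proof -
  define Q where "Q x s \<longleftrightarrow> (\<exists>v. \<forall>k. f (s k) x = v)" for x and s :: "nat \<Rightarrow> nat"
  interpret subseqs Q
  proof
    fix x and s :: "nat \<Rightarrow> nat"
    have "finite (range (\<lambda>k. f (s k) x))"
      by (rule finite_subset[of _ "{..b x}"]) (use assms in auto)
    then obtain k0 where k0: "infinite {k. f (s k) x = f (s k0) x}"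
      using pigeonhole_infinite[of UNIV "\<lambda>k. f (s k) x"] by auto
    define r' where "r' = enumerate {k. f (s k) x = f (s k0) x}"
    have "f (s (r' k)) x = f (s k0) x" for k
      using enumerate_in_set[OF k0, of k] by (simp add: r'_def)
    then have "Q x (s \<circ> r')"
      by (simp add: Q_def)
    moreover have "strict_mono r'"
      unfolding r'_def by (rule strict_mono_enumerate[OF k0])
    ultimately show "\<exists>r'. strict_mono r' \<and> Q x (s \<circ> r')"
      by blast
  qed
  \<comment> \<open>From index \<open>Suc x\<close> on, the diagonal sequence is a subsequence of
    one that is constant at \<open>x\<close>, and constancy passes to subsequences.\<close>
  have "Q x (diagseq \<circ> (+) (Suc x))" for x
    by (rule diagseq_holds) (auto simp: Q_def)
  then have "\<exists>v. \<forall>k. f (diagseq (Suc x + k)) x = v" for x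
    by (simp add: Q_def)
  then obtain T where "f (diagseq (Suc x + k)) x = T x" for x k
    by metis
  then have "\<forall>\<^sub>F k in sequentially. f (diagseq k) x = T x" for x
    unfolding eventually_sequentially by (metis le_Suc_ex)
  with subseq_diagseq show thesis
    by (rule that)
qed

text \<open>The maps for different \<open>N\<close> need not agree. A pointwise limit of a
  subsequence coincides on each \<open>{..N}\<close> with some map for a larger window, and
  restricting that map suffices.\<close>

lemma partial_rough_isometry_compact:
  assumes "\<And>N. \<exists>T. partial_rough_isometry c N A B T" "0 \<in> A"
  obtains T where "\<And>N. partial_rough_isometry c N A B T"
proof -
  obtain f where f: "\<And>N. partial_rough_isometry c N A B (f N)"
    using assms(1) by metis
  \<comment> \<open>Nothing controls \<open>f N\<close> outside \<open>A \<inter> {..N}\<close>; the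
    default 0 there gives a pointwise bound that is uniform in \<open>N\<close>.\<close>
  define g where "g N x = (if x \<in> A \<and> x \<le> N then f N x else 0)" for N x
  have f_le: "f N x \<le> c * x + c" if "x \<in> A" "x \<le> N" for N x
    using f[of N] assms(2) that
    by (intro bounded_distortion_le[of c "A \<inter> {..N}"]) (auto simp: partial_rough_isometry_def)
  have g: "partial_rough_isometry c N A B (g N)" for N
    using f[of N] partial_rough_isometry_cong[OF assms(2), of N "g N" "f N"] by (simp add: g_def)
  have "g N x \<le> c * x + c" for N x
    using f_le by (simp add: g_def)
  then obtain r T where r: "strict_mono r" and T: "\<And>x. \<forall>\<^sub>F k in sequentially. g (r k) x = T x"
    by (rule pointwise_bounded_convergent_subsequence[where f = g]) blast
  have "partial_rough_isometry c N A B T" for N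
  proof -
    have "\<forall>\<^sub>F k in sequentially. (\<forall>x\<in>{..N}. g (r k) x = T x) \<and> N \<le> k"
      using T by (intro eventually_conj eventually_ge_at_top) (auto simp: eventually_ball_finite)
    then obtain k where k: "\<And>x. x \<le> N \<Longrightarrow> g (r k) x = T x" "N \<le> k"
      unfolding eventually_sequentially by auto
    have "N \<le> r k"
      using k(2) seq_suble[OF r, of k] by linarith
    then have "partial_rough_isometry c N A B (g (r k))"
      by (rule partial_rough_isometry_antimono[OF g _ assms(2)])
    then show ?thesis
      using partial_rough_isometry_cong[OF assms(2), of N "g (r k)" T] k(1) by blast
  qed
  then show thesis
    by (rule that)
qed

text \<open>This replaces existence of a map on an infinite set by a countable conjunction of
  conditions on finite windows. Forwards, \<open>near_preimage_le\<close> places the witnesses;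
  backwards, density at \<open>y\<close> is read off from the window
  \<open>N = c * (y + 2 * c)\<close>.\<close>

lemma rooted_rough_isometric_with_iff_partial:
  assumes "0 \<in> A" "1 \<le> c"
  shows "rooted_rough_isometric_with c c c (real ` A) 0 (real ` B) 0 \<longleftrightarrow>
    (\<forall>N. \<exists>T. partial_rough_isometry c N A B T)"
proof
  assume "rooted_rough_isometric_with c c c (real ` A) 0 (real ` B) 0"
  then obtain T where T: "T ` A \<subseteq> B" "T 0 = 0" "bounded_distortion c A T"
      "\<And>y. y \<in> B \<Longrightarrow> \<exists>x\<in>A. \<bar>real y - real (T x)\<bar> \<le> c"
    using rooted_rough_isometric_with_nat_iff[OF assms, of c B] by auto
  have "partial_rough_isometry c N A B T" for N
  proof -
    have "\<exists>x\<in>A \<inter> {..N}. \<bar>real y - real (T x)\<bar> \<le> c" if "y \<in> B" "c * (y + 2 * c) \<le> N" for y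
      using T(4)[OF that(1)] near_preimage_le[OF T(3) assms(1) T(2)] that(2)
      by (meson IntI atMost_iff order_trans)
    then show ?thesis
      using T(1,2) bounded_distortion_subset[OF T(3), of "A \<inter> {..N}"]
      by (auto simp: partial_rough_isometry_def)
  qed
  then show "\<forall>N. \<exists>T. partial_rough_isometry c N A B T"
    by blast
next
  assume "\<forall>N. \<exists>T. partial_rough_isometry c N A B T"
  then obtain T where T: "\<And>N. partial_rough_isometry c N A B T"
    using partial_rough_isometry_compact[of c A B] assms(1) by blast
  have "T ` A \<subseteq> B"
    using T by (force simp: partial_rough_isometry_def)
  moreover have "bounded_distortion c A T"
    unfolding bounded_distortion_def
  proof (intro ballI)
    fix x1 x2 assume "x1 \<in> A" "x2 \<in> A"
    then show "\<bar>real x1 - real x2\<bar> \<le> c * (\<bar>real (T x1) - real (T x2)\<bar> + c) \<and>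
        \<bar>real (T x1) - real (T x2)\<bar> \<le> c * \<bar>real x1 - real x2\<bar> + c"
      using T[of "max x1 x2"] bounded_distortionD[of c "A \<inter> {..max x1 x2}" T x1 x2]
      by (auto simp: partial_rough_isometry_def)
  qed
  moreover have "\<exists>x\<in>A. \<bar>real y - real (T x)\<bar> \<le> c" if "y \<in> B" for y
    using T[of "c * (y + 2 * c)"] that by (auto simp: partial_rough_isometry_def)
  moreover have "T 0 = 0"
    using T by (auto simp: partial_rough_isometry_def)
  ultimately show "rooted_rough_isometric_with c c c (real ` A) 0 (real ` B) 0"
    using rooted_rough_isometric_with_nat_iff[OF assms, of c B] by blast
qed

section \<open>Passing between infinite sets and initial segments\<close>

lemma initial_segment_Suc:
  assumes "infinite A"
  shows "initial_segment A (Suc k) = A \<inter> {..enumerate A k}"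
proof -
  have "x \<in> enumerate A ` {..<Suc k}" if x: "x \<in> A" "x \<le> enumerate A k" for x
  proof -
    obtain j where "enumerate A j = x"
      using enumerate_Ex[OF assms x(1)] by blast
    with x(2) assms show ?thesis
      by (intro image_eqI[of _ _ j]) auto
  qed
  then show ?thesis
    using assms by (auto simp: initial_segment_def enumerate_in_set)
qed

lemma initial_segment_up_to:
  assumes "infinite B" "t \<in> B"
  shows "\<exists>m\<ge>1. initial_segment B m = B \<inter> {..t}"
proof -
  obtain j where "enumerate B j = t"
    using enumerate_Ex[OF assms] by blast
  then show ?thesis
    using initial_segment_Suc[OF assms(1), of j] by (intro exI[of _ "Suc j"]) simp
qed

text \<open>Density is known only up to the last target point \<open>t\<close>. If
  \<open>c * (y + 2 * c)\<close> is at most the last source point \<open>s\<close>, the lower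
  distortion bound at \<open>s\<close> gives \<open>y + c \<le> T s \<le> t\<close>, so
  \<open>y\<close> is in range. Finally \<open>k \<le> s\<close>, as \<open>s\<close> is the point
  of index \<open>k\<close> counted from 0.\<close>

lemma partial_rough_isometry_of_initial_segments:
  assumes "infinite A" "infinite B" "0 \<in> A" "1 \<le> c" "1 \<le> m"
    and "rooted_rough_isometric_with c c c
           (real ` initial_segment A (Suc k)) 0 (real ` initial_segment B m) 0"
  shows "\<exists>T. partial_rough_isometry c k A B T"
proof -
  define s where "s = enumerate A k"
  have s: "s \<in> A" "k \<le> s"
    using assms(1) by (auto simp: s_def enumerate_in_set le_enumerate)
  obtain t where t: "initial_segment B m = B \<inter> {..t}"
    using assms(2,5) by (cases m) (auto simp: initial_segment_Suc)
  obtain T where T: "T ` (A \<inter> {..s}) \<subseteq> B \<inter> {..t}" "T 0 = 0"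
      "bounded_distortion c (A \<inter> {..s}) T"
      "\<And>y. y \<in> B \<inter> {..t} \<Longrightarrow> \<exists>x\<in>A \<inter> {..s}. \<bar>real y - real (T x)\<bar> \<le> c"
    using assms(6) rooted_rough_isometric_with_nat_iff[of "A \<inter> {..s}" c c "B \<inter> {..t}"] assms(3,4)
    unfolding t initial_segment_Suc[OF assms(1)] s_def[symmetric] by auto
  have root: "0 \<in> A \<inter> {..s}" "s \<in> A \<inter> {..s}"
    using assms(3) s by auto
  have "\<exists>x\<in>A \<inter> {..s}. \<bar>real y - real (T x)\<bar> \<le> c" if y: "y \<in> B" "c * (y + 2 * c) \<le> s" for y
  proof -
    have "real (c * (y + 2 * c)) \<le> real s"
      using y by linarith
    also have "\<dots> \<le> c * (real (T s) + c)"
      using bounded_distortionD(1)[OF T(3) root(2,1)] T(2) by simp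
    finally have "c * (real y + 2 * c) \<le> c * (real (T s) + c)"
      by simp
    then have "real y + 2 * c \<le> real (T s) + c"
      using assms(4) by (subst (asm) mult_le_cancel_left_pos) auto
    moreover have "T s \<le> t"
      using T(1) root by blast
    ultimately show ?thesis
      using T(4)[of y] y(1) by auto
  qed
  then have "partial_rough_isometry c s A B T"
    using T unfolding partial_rough_isometry_def by blast
  then show ?thesis
    using partial_rough_isometry_antimono s(2) assms(3) by blast
qed

text \<open>Only density can fail after truncation. A point \<open>y\<close> is within
  \<open>c\<close> of some \<open>T x\<close>; the gap hypothesis forces \<open>x\<close> to be at
  most \<open>K\<close> beyond the last point \<open>s\<close>, so \<open>T x\<close> is within
  \<open>c * K + c\<close> of \<open>T s\<close>. The sum of both errors is the new
  constant.\<close>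

lemma rough_isometric_initial_segments:
  fixes A B :: "nat set" and c K k :: nat
  assumes "infinite A" "infinite B" "0 \<in> A" "1 \<le> c"
    and "rooted_rough_isometric_with c c c (real ` A) 0 (real ` B) 0"
    and gaps: "\<And>d. K < d \<Longrightarrow>
      A \<inter> {enumerate A k + d <.. enumerate A k + d + (d div c\<^sup>2 - 4)} \<noteq> {}"
  shows "\<exists>m\<ge>1. rooted_rough_isometric_with c c (2 * c + c * K)
           (real ` initial_segment A (Suc k)) 0 (real ` initial_segment B m) 0"
proof -
  define s where "s = enumerate A k"
  have s: "s \<in> A"
    using assms(1) by (auto simp: s_def enumerate_in_set)
  obtain T where T: "T ` A \<subseteq> B" "T 0 = 0" "bounded_distortion c A T"
      "\<And>y. y \<in> B \<Longrightarrow> \<exists>x\<in>A. \<bar>real y - real (T x)\<bar> \<le> c"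
    using assms(5) rooted_rough_isometric_with_nat_iff[OF assms(3,4), of c B] by auto
  define t where "t = Max (T ` (A \<inter> {..s}))"
  have fin: "finite (T ` (A \<inter> {..s}))" "T ` (A \<inter> {..s}) \<noteq> {}"
    using s by auto
  obtain u where u: "u \<in> A" "u \<le> s" "T u = t"
    using Max_in[OF fin] by (auto simp: t_def)
  have le_t: "T x \<le> t" if "x \<in> A" "x \<le> s" for x
    using that fin by (auto simp: t_def intro!: Max_ge)
  have "t \<in> B"
    using u T(1) by blast
  then obtain m where m: "1 \<le> m" "initial_segment B m = B \<inter> {..t}"
    using initial_segment_up_to[OF assms(2)] by blast
  have "\<exists>x\<in>A \<inter> {..s}. \<bar>real y - real (T x)\<bar> \<le> 2 * c + c * K" if y: "y \<in> B" "y \<le> t" for y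
  proof -
    obtain x where x: "x \<in> A" "\<bar>real y - real (T x)\<bar> \<le> c"
      using T(4) y(1) by blast
    show ?thesis
    proof (cases "x \<le> s")
      case True
      have "real c \<le> 2 * c + c * K" by simp
      with True x show ?thesis
        by (intro bexI[of _ x]) (auto intro: order_trans)
    next
      case False
      \<comment> \<open>The last element \<open>v\<close> of \<open>V\<close> is the last time at
        which \<open>T\<close> is not above \<open>t + c\<close>. The next point \<open>w\<close> of
        \<open>A\<close> has its image above this level, and \<open>x\<close> itself belongs to
        \<open>V\<close>.\<close>
      define V where "V = {v \<in> A. T v \<le> t + c}"
      have "finite V"
      proof (rule finite_subset)
        show "V \<subseteq> {..c * (t + 2 * c)}"
        proof
          fix v assume v: "v \<in> V"
          have "real v \<le> c * (real (T v) + c)"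
            using bounded_distortionD(1)[OF T(3) _ assms(3), of v] T(2) v by (simp add: V_def)
          also have "\<dots> \<le> c * (real (t + c) + c)"
            using v by (intro mult_left_mono) (auto simp: V_def)
          also have "\<dots> = real (c * (t + 2 * c))"
            by (simp add: algebra_simps)
          finally show "v \<in> {..c * (t + 2 * c)}"
            by (simp only: atMost_iff of_nat_le_iff)
        qed
      qed simp
      moreover have "real (T x) \<le> real (t + c)"
        using x(2) y(2) by linarith
      then have "x \<in> V"
        using x(1) unfolding V_def of_nat_le_iff by simp
      ultimately have "Max V \<in> V" and "x \<le> Max V"
        by (auto intro: Max_in)
      define v where "v = Max V"
      have v: "v \<in> A" "T v \<le> t + c" "x \<le> v"
        using \<open>Max V \<in> V\<close> \<open>x \<le> Max V\<close> by (auto simp: V_def v_def)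
      have beyond: "t + c < T w" if "w \<in> A" "v < w" for w
      proof -
        have "w \<notin> V"
          using that(2) Max_ge[OF \<open>finite V\<close>, of w] unfolding v_def by linarith
        with that(1) show ?thesis
          by (simp add: V_def)
      qed
      define w where "w = (LEAST w. w \<in> A \<and> v < w)"
      have "\<exists>w. w \<in> A \<and> v < w"
        using assms(1) by (meson infinite_nat_iff_unbounded)
      then have w: "w \<in> A" "v < w"
        unfolding w_def by (metis (mono_tags, lifting) LeastI_ex)+
      have gap: "A \<inter> {v <..< w} = {}"
        using not_less_Least[of _ "\<lambda>w. w \<in> A \<and> v < w"] by (auto simp: w_def)
      have jump: "real (T w) - real (T v) \<le> c * (real w - real v) + c"
        using bounded_distortionD(2)[OF T(3) w(1) v(1)] w(2) by simp
      \<comment> \<open>If \<open>T v\<close> is above \<open>t = T u\<close>, the excess is at most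
        \<open>c\<close>; if it is below, the jump to \<open>T w > t\<close> bounds the
        deficit.\<close>
      have "\<bar>real (T v) - real (T u)\<bar> \<le> c * (real w - real v) + c"
      proof -
        have "0 \<le> c * (real w - real v)"
          using w(2) by simp
        then show ?thesis
          using beyond[OF w] jump v(2) u(3) by linarith
      qed
      \<comment> \<open>Here \<open>u \<le> s < v\<close>, so a bound on the distance from
        \<open>u\<close> to \<open>v\<close> also bounds \<open>v - s\<close> in terms of the gap
        length.\<close>
      then have "\<bar>real v - real u\<bar> \<le> c * (c * (real w - real v) + c + c)"
        using bounded_distortionD(1)[OF T(3) v(1) u(1)]
        by (elim order_trans) (auto intro!: mult_left_mono)
      also have "\<dots> = (real c)\<^sup>2 * (real w - real v + 2)"
        by (simp add: power2_eq_square algebra_simps)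
      finally have "real v - real s \<le> (real c)\<^sup>2 * (real w - real v + 2)"
        using u(2) by linarith
      moreover have "real (v - s) = real v - real s" "real (w - v + 2) = real w - real v + 2"
        using v(3) w(2) False by auto
      ultimately have "real (v - s) \<le> real (c\<^sup>2 * (w - v + 2))"
        by (simp only: of_nat_mult of_nat_power)
      then have "v - s \<le> c\<^sup>2 * (w - v + 2)"
        by (simp only: of_nat_le_iff)
      then have "(v - s) div c\<^sup>2 \<le> w - v + 2"
        using assms(4) by (metis div_le_mono nonzero_mult_div_cancel_left not_one_le_zero power_not_zero)
      \<comment> \<open>If the truncated difference is 0, this is \<open>v < w\<close>; otherwise it
        is at most \<open>w - v - 2\<close>. So the interval tested by \<open>gaps\<close> at
        \<open>d = v - s\<close> lies strictly between \<open>v\<close> and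
        \<open>w\<close>.\<close>
      then have small: "s + (v - s) + ((v - s) div c\<^sup>2 - 4) < w"
        using w(2) v(3) False by linarith
      have "v - s \<le> K"
      proof (rule ccontr)
        assume "\<not> v - s \<le> K"
        then obtain z where "z \<in> A \<inter> {s + (v - s) <.. s + (v - s) + ((v - s) div c\<^sup>2 - 4)}"
          using gaps[of "v - s"] unfolding s_def[symmetric] by fastforce
        then have "z \<in> A" "s + (v - s) < z" "z \<le> s + (v - s) + ((v - s) div c\<^sup>2 - 4)"
          by (simp_all only: Int_iff greaterThanAtMost_iff)
        with small gap v(3) False show False
          by auto
      qed
      then have "real x - real s \<le> K"
        using v(3) False by linarith
      then have "c * \<bar>real x - real s\<bar> \<le> c * real K"
        using False by (intro mult_left_mono) auto
      then have "\<bar>real (T x) - real (T s)\<bar> \<le> c * real K + c"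
        using bounded_distortionD(2)[OF T(3) x(1) s] by linarith
      then have "\<bar>real y - real (T s)\<bar> \<le> 2 * c + c * K"
        using x(2) by simp
      then show ?thesis
        using s by blast
    qed
  qed
  moreover have "T ` (A \<inter> {..s}) \<subseteq> B \<inter> {..t}"
    using T(1) le_t by auto
  moreover have "bounded_distortion c (A \<inter> {..s}) T"
    using T(3) by (rule bounded_distortion_subset) auto
  ultimately have "rooted_rough_isometric_with c c (2 * c + c * K) (real ` (A \<inter> {..s})) 0 (real ` (B \<inter> {..t})) 0"
    using T(2) assms(3,4) rooted_rough_isometric_with_nat_iff[of "A \<inter> {..s}" c "2 * c + c * K" "B \<inter> {..t}"]
    by auto
  then show ?thesis
    using m unfolding initial_segment_Suc[OF assms(1)] s_def[symmetric] by (intro exI[of _ m]) simp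
qed

section \<open>Gaps of a percolation\<close>

text \<open>A finite window has finitely many possible traces, so the event is a finite union for an
  arbitrary predicate \<open>Q\<close>.\<close>

lemma sets_Collect_inter_finite:
  fixes A B :: "'w \<Rightarrow> nat set"
  assumes [measurable]: "\<And>n. Measurable.pred M (\<lambda>\<omega>. n \<in> A \<omega>)" "\<And>n. Measurable.pred M (\<lambda>\<omega>. n \<in> B \<omega>)"
    and "finite J"
  shows "{\<omega> \<in> space M. Q (A \<omega> \<inter> J) (B \<omega> \<inter> J)} \<in> sets M"
proof -
  have "{\<omega> \<in> space M. Q (A \<omega> \<inter> J) (B \<omega> \<inter> J)} =
      (\<Union>(S, S') \<in> {(S, S') \<in> Pow J \<times> Pow J. Q S S'}.
         {\<omega> \<in> space M. \<forall>n\<in>J. (n \<in> A \<omega> \<longleftrightarrow> n \<in> S) \<and> (n \<in> B \<omega> \<longleftrightarrow> n \<in> S')})" (is "?L = ?R")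
  proof
    show "?L \<subseteq> ?R"
    proof
      fix \<omega> assume "\<omega> \<in> ?L"
      then show "\<omega> \<in> ?R"
        by (intro UN_I[of "(A \<omega> \<inter> J, B \<omega> \<inter> J)"]) auto
    qed
    show "?R \<subseteq> ?L"
    proof
      fix \<omega> assume "\<omega> \<in> ?R"
      then obtain S S' where S: "S \<subseteq> J" "S' \<subseteq> J" "Q S S'" "\<omega> \<in> space M"
          "\<And>n. n \<in> J \<Longrightarrow> (n \<in> A \<omega> \<longleftrightarrow> n \<in> S) \<and> (n \<in> B \<omega> \<longleftrightarrow> n \<in> S')"
        by auto
      then have "A \<omega> \<inter> J = S" "B \<omega> \<inter> J = S'"
        by auto
      with S show "\<omega> \<in> ?L"
        by simp
    qed
  qed
  also have "\<dots> \<in> sets M"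
    using assms(3) by (intro sets.finite_UN) (auto intro: finite_subset[of _ "Pow J \<times> Pow J"])
  finally show ?thesis .
qed

text \<open>The recursion for \<open>enumerate\<close> deletes the least element, so the induction
  must range over all random sets.\<close>

lemma measurable_enumerate:
  fixes A :: "'w \<Rightarrow> nat set"
  assumes "\<And>n. Measurable.pred M (\<lambda>\<omega>. n \<in> A \<omega>)"
  shows "(\<lambda>\<omega>. enumerate (A \<omega>) k) \<in> measurable M (count_space UNIV)"
  using assms
proof (induction k arbitrary: A)
  case 0
  then show ?case
    unfolding enumerate_0 by measurable
next
  case (Suc k)
  have least[measurable]: "(\<lambda>\<omega>. LEAST n. n \<in> A \<omega>) \<in> measurable M (count_space UNIV)"
    using Suc.prems by measurable
  have "Measurable.pred M (\<lambda>\<omega>. n \<in> A \<omega> - {LEAST n. n \<in> A \<omega>})" for n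
    using Suc.prems unfolding Diff_iff singleton_iff by measurable
  then show ?case
    unfolding enumerate_Suc by (rule Suc.IH)
qed

lemma finite_initial_segment: "finite (initial_segment A n)"
  by (simp add: initial_segment_def)

lemma sets_initial_segment_eq:
  fixes A :: "'w \<Rightarrow> nat set"
  assumes "\<And>n. Measurable.pred M (\<lambda>\<omega>. n \<in> A \<omega>)"
  shows "{\<omega> \<in> space M. initial_segment (A \<omega>) n = S} \<in> sets M"
proof -
  have [measurable]: "(\<lambda>\<omega>. enumerate (A \<omega>) k) \<in> measurable M (count_space UNIV)" for k
    using assms by (rule measurable_enumerate)
  have "{\<omega> \<in> space M. initial_segment (A \<omega>) n = S} =
      {\<omega> \<in> space M. \<forall>x. x \<in> S \<longleftrightarrow> (\<exists>k\<in>{..<n}. enumerate (A \<omega>) k = x)}"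
    by (auto simp: initial_segment_def)
  also have "\<dots> \<in> sets M"
    by measurable
  finally show ?thesis .
qed

text \<open>Initial segments are finite, and there are countably many finite sets of naturals, so
  again \<open>Q\<close> may be arbitrary.\<close>

lemma sets_initial_segments:
  fixes A B :: "'w \<Rightarrow> nat set"
  assumes "\<And>n. Measurable.pred M (\<lambda>\<omega>. n \<in> A \<omega>)" "\<And>n. Measurable.pred M (\<lambda>\<omega>. n \<in> B \<omega>)"
  shows "{\<omega> \<in> space M. \<exists>m\<ge>1. Q (initial_segment (A \<omega>) n) (initial_segment (B \<omega>) m)} \<in> sets M"
proof -
  define E where "E m S S' =
    {\<omega> \<in> space M. initial_segment (A \<omega>) n = S} \<inter> {\<omega> \<in> space M. initial_segment (B \<omega>) m = S'}" for m S S'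
  have E: "E m S S' \<in> sets M" for m S S'
    unfolding E_def by (intro sets.Int sets_initial_segment_eq assms)
  have "{\<omega> \<in> space M. \<exists>m\<ge>1. Q (initial_segment (A \<omega>) n) (initial_segment (B \<omega>) m)} =
      (\<Union>m\<in>{1..}. \<Union>S\<in>Collect finite. \<Union>S'\<in>{S'. finite S' \<and> Q S S'}. E m S S')" (is "?L = ?R")
  proof
    show "?L \<subseteq> ?R"
    proof
      fix \<omega> assume "\<omega> \<in> ?L"
      then obtain m where "\<omega> \<in> space M" "1 \<le> m" "Q (initial_segment (A \<omega>) n) (initial_segment (B \<omega>) m)"
        by blast
      then show "\<omega> \<in> ?R"
        by (intro UN_I[of m] UN_I[of "initial_segment (A \<omega>) n"] UN_I[of "initial_segment (B \<omega>) m"])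
          (simp_all add: E_def finite_initial_segment)
    qed
    show "?R \<subseteq> ?L"
      unfolding E_def by blast
  qed
  also have "\<dots> \<in> sets M"
  proof (rule sets.countable_UN'')
    fix m :: nat assume "m \<in> {1..}"
    show "(\<Union>S\<in>Collect finite. \<Union>S'\<in>{S'. finite S' \<and> Q S S'}. E m S S') \<in> sets M"
    proof (rule sets.countable_UN''[OF countable_Collect_finite])
      fix S
      have "countable {S'. finite S' \<and> Q S S'}"
        by (rule countable_subset[OF _ countable_Collect_finite]) blast
      then show "(\<Union>S'\<in>{S'. finite S' \<and> Q S S'}. E m S S') \<in> sets M"
        using E by (rule sets.countable_UN'')
    qed
  qed simp
  finally show ?thesis .
qed

text \<open>Comparison with the geometric series of ratio \<open>(1 / 2) powr (1 / q)\<close>. The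
  factor 32 is 2 to the power 5: four for the subtracted 4 and one for rounding in
  \<open>div\<close>.\<close>

lemma summable_half_power_div:
  assumes "1 \<le> q"
  shows "summable (\<lambda>d. (1 / 2 :: real) ^ (d div q - 4))"
proof (rule summable_comparison_test')
  define r :: real where "r = (1 / 2) powr (1 / q)"
  have "0 \<le> r" "r < 1"
    unfolding r_def using assms powr_less_mono'[of "1 / 2" 0 "1 / q"] by simp_all
  then show "summable (\<lambda>d. 32 * r ^ d)"
    by (simp add: summable_geometric summable_mult)
  have r_power: "r ^ d = (1 / 2) powr (d * (1 / q))" for d
    unfolding r_def by (rule powr_power) simp
  show "norm ((1 / 2 :: real) ^ (d div q - 4)) \<le> 32 * r ^ d" if "0 \<le> d" for d
  proof -
    have "real d / q \<le> real (d div q) + 1"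
      using floor_divide_of_nat_eq[of d q, where 'a = real] by linarith
    also have "\<dots> \<le> real (d div q - 4 + 5)"
      by simp
    finally have "d * (1 / q) \<le> real (d div q - 4 + 5)"
      by simp
    then have "(1 / 2) powr real (d div q - 4 + 5) \<le> r ^ d"
      unfolding r_power by (rule powr_mono') simp_all
    moreover have "(1 / 2) powr real (d div q - 4 + 5) = (1 / 2 :: real) ^ (d div q - 4 + 5)"
      by (rule powr_realpow) simp
    moreover have "(1 / 2 :: real) ^ (d div q - 4 + 5) = (1 / 2) ^ (d div q - 4) * (1 / 32)"
      by (simp add: power_add power_divide)
    moreover have "norm ((1 / 2 :: real) ^ (d div q - 4)) = (1 / 2) ^ (d div q - 4)"
      by simp
    ultimately show ?thesis
      by linarith
  qed
qed

section \<open>The law of a percolation on finite windows\<close>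

locale rooted_percolation = prob_space P for P :: "'w measure" +
  fixes A :: "'w \<Rightarrow> nat set"
  assumes percolation: "rooted_bernoulli_percolation P A"
begin

lemma root_mem: "\<omega> \<in> space P \<Longrightarrow> 0 \<in> A \<omega>"
  using percolation by (simp add: rooted_bernoulli_percolation_def)

lemma indep_mem: "indep_vars (\<lambda>_. count_space UNIV) (\<lambda>n \<omega>. n \<in> A \<omega>) {1..}"
  using percolation by (simp add: rooted_bernoulli_percolation_def)

lemma prob_mem: "1 \<le> n \<Longrightarrow> prob {\<omega> \<in> space P. n \<in> A \<omega>} = 1 / 2"
  using percolation by (simp add: rooted_bernoulli_percolation_def)

lemma pred_mem [measurable]: "Measurable.pred P (\<lambda>\<omega>. n \<in> A \<omega>)"
proof (cases "n = 0")
  case True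
  then have "Measurable.pred P (\<lambda>\<omega>. n \<in> A \<omega>) \<longleftrightarrow> Measurable.pred P (\<lambda>\<omega>. True)"
    by (intro measurable_cong) (simp add: root_mem)
  then show ?thesis
    by simp
next
  case False
  then show ?thesis
    using indep_mem unfolding indep_vars_def by auto
qed

lemma sets_inter [measurable]: "finite J \<Longrightarrow> {\<omega> \<in> space P. Q (A \<omega> \<inter> J)} \<in> events"
  using sets_Collect_inter_finite[where M = P and A = A and B = A and Q = "\<lambda>S _. Q S"] by simp

lemma prob_inter_eq:
  assumes "finite J" "J \<subseteq> {1..}" "S \<subseteq> J"
  shows "prob {\<omega> \<in> space P. A \<omega> \<inter> J = S} = (1 / 2) ^ card J"
proof (cases "J = {}")
  \<comment> \<open>Treated apart because an intersection over an empty index set is the whole type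
    rather than \<open>space P\<close>.\<close>
  case True
  with assms show ?thesis
    by (simp add: prob_space)
next
  case False
  have single: "prob ((\<lambda>\<omega>. j \<in> A \<omega>) -` {j \<in> S} \<inter> space P) = 1 / 2" if "j \<in> J" for j
  proof (cases "j \<in> S")
    case True
    then have "(\<lambda>\<omega>. j \<in> A \<omega>) -` {j \<in> S} \<inter> space P = {\<omega> \<in> space P. j \<in> A \<omega>}"
      by auto
    with that assms(2) show ?thesis
      using prob_mem[of j] by auto
  next
    case False
    then have "(\<lambda>\<omega>. j \<in> A \<omega>) -` {j \<in> S} \<inter> space P = space P - {\<omega> \<in> space P. j \<in> A \<omega>}"
      by auto
    moreover have "prob (space P - {\<omega> \<in> space P. j \<in> A \<omega>}) = 1 - prob {\<omega> \<in> space P. j \<in> A \<omega>}"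
      by (intro prob_compl) measurable
    ultimately show ?thesis
      using that assms(2) prob_mem[of j] by auto
  qed
  have "{\<omega> \<in> space P. A \<omega> \<inter> J = S} = (\<Inter>j\<in>J. (\<lambda>\<omega>. j \<in> A \<omega>) -` {j \<in> S} \<inter> space P)"
    using assms(3) False by auto
  also have "prob \<dots> = (\<Prod>j\<in>J. prob ((\<lambda>\<omega>. j \<in> A \<omega>) -` {j \<in> S} \<inter> space P))"
    using assms False by (intro indep_varsD[OF indep_mem]) auto
  also have "\<dots> = (1 / 2) ^ card J"
    by (simp add: single)
  finally show ?thesis .
qed

text \<open>The trace on \<open>J\<close> is uniformly distributed on \<open>Pow J\<close>, so
  probabilities reduce to counting.\<close>

lemma prob_inter_in:
  assumes "finite J" "J \<subseteq> {1..}" "\<S> \<subseteq> Pow J"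
  shows "prob {\<omega> \<in> space P. A \<omega> \<inter> J \<in> \<S>} = card \<S> * (1 / 2) ^ card J"
proof -
  have "finite \<S>"
    using assms finite_subset by blast
  have "{\<omega> \<in> space P. A \<omega> \<inter> J \<in> \<S>} = (\<Union>S\<in>\<S>. {\<omega> \<in> space P. A \<omega> \<inter> J = S})"
    by auto
  also have "prob \<dots> = (\<Sum>S\<in>\<S>. prob {\<omega> \<in> space P. A \<omega> \<inter> J = S})"
    using \<open>finite \<S>\<close> sets_inter[OF assms(1)]
    by (intro finite_measure_finite_Union) (auto simp: disjoint_family_on_def)
  also have "\<dots> = (\<Sum>S\<in>\<S>. (1 / 2) ^ card J)"
    using assms by (intro sum.cong prob_inter_eq) auto
  finally show ?thesis
    by simp
qed

text \<open>The same family of subsets of \<open>J\<close> describes both events: a trace on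
  \<open>J \<union> I\<close> that belongs to it automatically misses \<open>I\<close>. Only the
  normalising power of 1/2 changes.\<close>

lemma prob_inter_disjoint:
  assumes "finite J" "J \<subseteq> {1..}" "finite I" "I \<subseteq> {1..}" "J \<inter> I = {}"
  shows "prob {\<omega> \<in> space P. Q (A \<omega> \<inter> J) \<and> A \<omega> \<inter> I = {}} =
    prob {\<omega> \<in> space P. Q (A \<omega> \<inter> J)} * (1 / 2) ^ card I"
proof -
  define \<S> where "\<S> = {S \<in> Pow J. Q S}"
  have "{\<omega> \<in> space P. Q (A \<omega> \<inter> J) \<and> A \<omega> \<inter> I = {}} = {\<omega> \<in> space P. A \<omega> \<inter> (J \<union> I) \<in> \<S>}"
  proof -
    have "Q (U \<inter> J) \<and> U \<inter> I = {} \<longleftrightarrow> U \<inter> (J \<union> I) \<in> \<S>" for U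
    proof
      assume "Q (U \<inter> J) \<and> U \<inter> I = {}"
      then show "U \<inter> (J \<union> I) \<in> \<S>"
        by (simp add: \<S>_def Int_Un_distrib)
    next
      assume *: "U \<inter> (J \<union> I) \<in> \<S>"
      then have "U \<inter> I = {}"
        using assms(5) by (auto simp: \<S>_def)
      with * show "Q (U \<inter> J) \<and> U \<inter> I = {}"
        by (simp add: \<S>_def Int_Un_distrib)
    qed
    then show ?thesis
      by simp
  qed
  also have "prob \<dots> = card \<S> * (1 / 2) ^ card (J \<union> I)"
    using assms by (intro prob_inter_in) (auto simp: \<S>_def)
  also have "\<dots> = card \<S> * (1 / 2) ^ card J * (1 / 2) ^ card I"
    using assms by (simp add: card_Un_disjoint power_add)
  also have "card \<S> * (1 / 2) ^ card J = prob {\<omega> \<in> space P. A \<omega> \<inter> J \<in> \<S>}"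
    using assms by (intro prob_inter_in[symmetric]) (auto simp: \<S>_def)
  also have "{\<omega> \<in> space P. A \<omega> \<inter> J \<in> \<S>} = {\<omega> \<in> space P. Q (A \<omega> \<inter> J)}"
    by (auto simp: \<S>_def)
  finally show ?thesis .
qed

text \<open>For fixed \<open>s\<close>, no point beyond \<open>s\<close> has probability at most
  \<open>(1 / 2) ^ l\<close> for every \<open>l\<close>, hence 0; there are countably many
  \<open>s\<close>.\<close>

lemma AE_infinite: "AE \<omega> in P. infinite (A \<omega>)"
proof -
  have "AE \<omega> in P. \<exists>l. A \<omega> \<inter> {s<..s + l} \<noteq> {}" for s
  proof -
    define E where "E = {\<omega> \<in> space P. \<forall>l. A \<omega> \<inter> {s<..s + l} = {}}"
    have E: "E \<in> events"
      unfolding E_def using sets_inter[of "{s<..s + _}" "\<lambda>S. S = {}"] by (intro sets.sets_Collect_countable_All) auto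
    have "prob E \<le> (1 / 2) ^ l" for l
    proof -
      have "prob E \<le> prob {\<omega> \<in> space P. A \<omega> \<inter> {s<..s + l} = {}}"
        using sets_inter[of "{s<..s + l}" "\<lambda>S. S = {}"] by (intro finite_measure_mono) (auto simp: E_def)
      also have "\<dots> = (1 / 2) ^ l"
        by (subst prob_inter_eq) auto
      finally show ?thesis .
    qed
    then have "prob E \<le> 0"
      by (intro LIMSEQ_le_const[OF LIMSEQ_power_zero[of "1 / 2 :: real"]]) auto
    then have "prob E = 0"
      by (simp add: measure_le_0_iff)
    then have "AE \<omega> in P. \<omega> \<notin> E"
      using E prob_eq_0 by blast
    then show ?thesis
      using AE_space by eventually_elim (auto simp: E_def)
  qed
  then have "AE \<omega> in P. \<forall>s. \<exists>l. A \<omega> \<inter> {s<..s + l} \<noteq> {}"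
    by (simp add: AE_all_countable)
  then show ?thesis
  proof eventually_elim
    fix \<omega> assume *: "\<forall>s. \<exists>l. A \<omega> \<inter> {s<..s + l} \<noteq> {}"
    have "\<exists>n>s. n \<in> A \<omega>" for s
      using *[rule_format, of s] by auto
    then show "infinite (A \<omega>)"
      by (simp add: infinite_nat_iff_unbounded)
  qed
qed

section \<open>Long gaps to the right of the point of index \<open>k\<close>\<close>

text \<open>
  The point \<open>s\<close> is \<open>enumerate (A \<omega>) k\<close>; it is specified through \<open>A \<omega> \<inter> {..s}\<close> only, which makes
  the condition on \<open>s\<close> independent of the gaps to its right.
\<close>

definition bad_gap :: "nat \<Rightarrow> nat \<Rightarrow> nat \<Rightarrow> 'w set" where
  "bad_gap q K k = (\<Union>s. \<Union>i. {\<omega> \<in> space P. s \<in> A \<omega> \<and> card (A \<omega> \<inter> {..<s}) = k \<and>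
     A \<omega> \<inter> {s + (i + K) <.. s + (i + K) + ((i + K) div q - 4)} = {}})"

text \<open>For each candidate \<open>s\<close>, independence and a union bound over gap positions
  give the factor on the right. The events locating the point at \<open>s\<close> are disjoint for
  different \<open>s\<close>, so their probabilities sum to at most 1, and the bound is uniform in
  \<open>k\<close>.\<close>

lemma bad_gap:
  assumes "1 \<le> q"
  shows "bad_gap q K k \<in> events"
    and "prob (bad_gap q K k) \<le> (\<Sum>i. (1 / 2) ^ ((i + K) div q - 4))"
proof -
  define H where "H s = {\<omega> \<in> space P. s \<in> A \<omega> \<and> card (A \<omega> \<inter> {..<s}) = k}" for s
  define l where "l i = (i + K) div q - 4" for i
  define G where "G s i = {\<omega> \<in> space P. s \<in> A \<omega> \<and> card (A \<omega> \<inter> {..<s}) = k \<and>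
     A \<omega> \<inter> {s + (i + K) <.. s + (i + K) + l i} = {}}" for s i
  \<comment> \<open>The formulas for finite windows concern sites from 1 on; the deterministic root
    is put back by \<open>insert 0\<close>.\<close>
  define Q where "Q s S \<longleftrightarrow> s \<in> insert 0 S \<and> card (insert 0 S \<inter> {..<s}) = k" for s :: nat and S
  have Q: "s \<in> A \<omega> \<and> card (A \<omega> \<inter> {..<s}) = k \<longleftrightarrow> Q s (A \<omega> \<inter> {1..s})" if "\<omega> \<in> space P" for \<omega> s
  proof -
    have "insert 0 (A \<omega> \<inter> {1..s}) = A \<omega> \<inter> {..s}"
    proof -
      have "{..s} = insert 0 {1..s}"
        by auto
      then show ?thesis
        using root_mem[OF that] by (simp only: Int_insert_right_if1)
    qed
    moreover have "A \<omega> \<inter> {..s} \<inter> {..<s} = A \<omega> \<inter> {..<s}"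
      by auto
    ultimately show ?thesis
      by (simp add: Q_def)
  qed
  have H_eq: "H s = {\<omega> \<in> space P. Q s (A \<omega> \<inter> {1..s})}" for s
    using Q by (auto simp: H_def)
  have G_eq: "G s i = {\<omega> \<in> space P. Q s (A \<omega> \<inter> {1..s}) \<and> A \<omega> \<inter> {s + (i + K) <.. s + (i + K) + l i} = {}}" for s i
    using Q by (auto simp: G_def)
  have H_events: "H s \<in> events" for s
    unfolding H_eq by (rule sets_inter) simp
  have G_events: "G s i \<in> events" for s i
  proof -
    have "G s i = H s \<inter> {\<omega> \<in> space P. A \<omega> \<inter> {s + (i + K) <.. s + (i + K) + l i} = {}}"
      by (auto simp: G_def H_def)
    then show ?thesis
      using H_events sets_inter[of "{s + (i + K) <.. s + (i + K) + l i}" "\<lambda>S. S = {}"] by auto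
  qed
  have bad_eq: "bad_gap q K k = (\<Union>s. \<Union>i. G s i)"
    by (simp add: bad_gap_def G_def l_def)
  show "bad_gap q K k \<in> events"
    unfolding bad_eq using G_events by blast
  have sum_l: "summable (\<lambda>i. (1 / 2 :: real) ^ l i)"
    unfolding l_def using summable_half_power_div[OF assms] by (subst summable_iff_shift)
  define \<epsilon> :: real where "\<epsilon> = (\<Sum>i. (1 / 2) ^ l i)"
  have prob_G: "prob (G s i) = prob (H s) * (1 / 2) ^ l i" for s i
    unfolding H_eq G_eq by (subst prob_inter_disjoint) auto
  have prob_UN_G: "prob (\<Union>i. G s i) \<le> prob (H s) * \<epsilon>" for s
  proof -
    have "prob (\<Union>i. G s i) \<le> (\<Sum>i. prob (G s i))"
      using G_events sum_l by (intro finite_measure_subadditive_countably) (auto simp: prob_G intro: summable_mult)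
    also have "\<dots> = prob (H s) * \<epsilon>"
      using sum_l by (simp add: prob_G \<epsilon>_def suminf_mult)
    finally show ?thesis .
  qed
  \<comment> \<open>The number of points below \<open>s\<close> increases strictly as
    \<open>s\<close> runs through the points of \<open>A \<omega>\<close>.\<close>
  have "disjoint_family H"
  proof -
    have "s = s'" if "\<omega> \<in> H s" "\<omega> \<in> H s'" for s s' \<omega>
    proof (rule ccontr)
      assume "s \<noteq> s'"
      define a b where "a = min s s'" and "b = max s s'"
      have ab: "a < b" "a \<in> A \<omega>" "card (A \<omega> \<inter> {..<a}) = card (A \<omega> \<inter> {..<b})"
        using that \<open>s \<noteq> s'\<close> by (auto simp: a_def b_def H_def min_def max_def)
      have "A \<omega> \<inter> {..<a} \<subset> A \<omega> \<inter> {..<b}"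
        using ab by auto
      then have "card (A \<omega> \<inter> {..<a}) < card (A \<omega> \<inter> {..<b})"
        by (intro psubset_card_mono) auto
      with ab show False
        by simp
    qed
    then show ?thesis
      by (auto simp: disjoint_family_on_def)
  qed
  then have sums_H: "(\<lambda>s. prob (H s)) sums prob (\<Union>s. H s)"
    using H_events by (intro finite_measure_UNION) auto
  have sum_H: "summable (\<lambda>s. prob (H s) * \<epsilon>)"
    using sums_H by (intro summable_mult2) (rule sums_summable)
  have sum_UN_G: "summable (\<lambda>s. prob (\<Union>i. G s i))"
    using sum_H by (rule summable_comparison_test') (use prob_UN_G in auto)
  have "range (\<lambda>s. \<Union>i. G s i) \<subseteq> events"
    using G_events by blast
  then have "prob (bad_gap q K k) \<le> (\<Sum>s. prob (\<Union>i. G s i))"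
    unfolding bad_eq using sum_UN_G by (rule finite_measure_subadditive_countably)
  also have "\<dots> \<le> (\<Sum>s. prob (H s) * \<epsilon>)"
    by (rule suminf_le[OF prob_UN_G sum_UN_G sum_H])
  also have "\<dots> = prob (\<Union>s. H s) * \<epsilon>"
    using sums_H by (simp add: sums_iff suminf_mult2[symmetric])
  also have "\<dots> \<le> 1 * \<epsilon>"
    using sum_l by (intro mult_right_mono prob_le_1) (auto simp: \<epsilon>_def intro!: suminf_nonneg)
  finally show "prob (bad_gap q K k) \<le> (\<Sum>i. (1 / 2) ^ ((i + K) div q - 4))"
    by (simp add: \<epsilon>_def l_def)
qed

text \<open>With indices counted from 0, the point of index \<open>k\<close> has exactly
  \<open>k\<close> points of the set below it, which is how \<open>bad_gap\<close> locates
  it.\<close>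

lemma not_bad_gapD:
  assumes "\<omega> \<in> space P" "\<omega> \<notin> bad_gap q K k" "infinite (A \<omega>)" "K < d"
  shows "A \<omega> \<inter> {enumerate (A \<omega>) k + d <.. enumerate (A \<omega>) k + d + (d div q - 4)} \<noteq> {}"
proof -
  define s where "s = enumerate (A \<omega>) k"
  have "A \<omega> \<inter> {..<s} = initial_segment (A \<omega>) (Suc k) - {s}"
    unfolding initial_segment_Suc[OF assms(3)] s_def by auto
  also have "\<dots> = enumerate (A \<omega>) ` {..<k}"
    using inj_enumerate[OF assms(3)] by (auto simp: initial_segment_def s_def lessThan_Suc inj_on_def)
  finally have "card (A \<omega> \<inter> {..<s}) = k"
    using inj_enumerate[OF assms(3)] by (simp add: card_image inj_on_subset)
  moreover have "s \<in> A \<omega>"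
    using assms(3) by (simp add: s_def enumerate_in_set)
  moreover have "d = d - K + K"
    using assms(4) by simp
  ultimately have "\<omega> \<in> bad_gap q K k" if "A \<omega> \<inter> {s + d <.. s + d + (d div q - 4)} = {}"
    unfolding bad_gap_def using assms(1) that by (intro UN_I[of s] UN_I[of "d - K"]) simp_all
  then show ?thesis
    using assms(2) by (auto simp only: s_def)
qed

end

section \<open>Approximation by local events\<close>

locale rooted_percolation_pair =
  A: rooted_percolation P A + B: rooted_percolation P B
  for P :: "'w measure" and A B :: "'w \<Rightarrow> nat set"
begin

definition partial_event :: "nat \<Rightarrow> nat \<Rightarrow> 'w set" where
  "partial_event c N = {\<omega> \<in> space P. \<exists>T. partial_rough_isometry c N (A \<omega>) (B \<omega>) T}"

lemma sets_partial_event: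
  assumes "1 \<le> c"
  shows "partial_event c N \<in> A.events"
proof -
  \<comment> \<open>This window contains both \<open>{..N}\<close> and the possible images of its
    points, so locality applies in both directions between a set and its trace.\<close>
  define J where "J = {..c * N + c}"
  have "N \<le> c * N + c"
    using assms by (cases c) auto
  then have trace: "U \<inter> J \<inter> {..N} = U \<inter> {..N}" "U \<inter> J \<inter> {..c * N + c} = U \<inter> {..c * N + c}" for U
    by (auto simp: J_def)
  have "partial_rough_isometry c N (A \<omega> \<inter> J) (B \<omega> \<inter> J) T \<longleftrightarrow> partial_rough_isometry c N (A \<omega>) (B \<omega>) T"
    if "\<omega> \<in> space P" for \<omega> T
  proof -
    have "0 \<in> A \<omega>" "0 \<in> A \<omega> \<inter> J"
      using A.root_mem[OF that] by (simp_all add: J_def)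
    then show ?thesis
      using assms trace by (metis partial_rough_isometry_local)
  qed
  then have "partial_event c N =
      {\<omega> \<in> space P. \<exists>T. partial_rough_isometry c N (A \<omega> \<inter> J) (B \<omega> \<inter> J) T}"
    unfolding partial_event_def by blast
  also have "\<dots> \<in> A.events"
    by (rule sets_Collect_inter_finite[OF A.pred_mem B.pred_mem]) (simp add: J_def)
  finally show ?thesis .
qed

lemma decseq_partial_event: "decseq (partial_event c)"
  unfolding decseq_def partial_event_def
  using partial_rough_isometry_antimono A.root_mem by blast

lemma Inter_partial_event:
  assumes "1 \<le> c"
  shows "(\<Inter>N. partial_event c N) =
    {\<omega> \<in> space P. rooted_rough_isometric_with c c c (real ` A \<omega>) 0 (real ` B \<omega>) 0}"
  using rooted_rough_isometric_with_iff_partial[OF A.root_mem assms]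
  by (auto simp: partial_event_def)

lemma sets_Inter_partial_event: "1 \<le> c \<Longrightarrow> (\<Inter>N. partial_event c N) \<in> A.events"
  using sets_partial_event by (intro sets.countable_INT') auto

text \<open>Natural constants turn the union over all real triples into a countable one.\<close>

lemma rooted_rough_isometric_event:
  "{\<omega> \<in> space P. rooted_rough_isometric (real ` A \<omega>) 0 (real ` B \<omega>) 0} =
    (\<Union>c\<in>{1..}. \<Inter>N. partial_event c N)" (is "?L = ?R")
proof
  show "?L \<subseteq> ?R"
  proof
    fix \<omega> assume "\<omega> \<in> ?L"
    then obtain M D R where "\<omega> \<in> space P" "0 < M"
        "rooted_rough_isometric_with M D R (real ` A \<omega>) 0 (real ` B \<omega>) 0"
      by (auto simp: rooted_rough_isometric_def)
    then obtain c :: nat where "1 \<le> c"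
        "rooted_rough_isometric_with c c c (real ` A \<omega>) 0 (real ` B \<omega>) 0"
      using rooted_rough_isometric_nat_constant[of M D R] by metis
    with \<open>\<omega> \<in> space P\<close> show "\<omega> \<in> ?R"
      by (intro UN_I[of c]) (simp_all only: Inter_partial_event mem_Collect_eq atLeast_iff simp_thms)
  qed
  show "?R \<subseteq> ?L"
  proof
    fix \<omega> assume "\<omega> \<in> ?R"
    then obtain c where "1 \<le> c" "\<omega> \<in> (\<Inter>N. partial_event c N)"
      by blast
    then have "\<omega> \<in> space P" "rooted_rough_isometric_with c c c (real ` A \<omega>) 0 (real ` B \<omega>) 0"
      by (simp_all only: Inter_partial_event mem_Collect_eq)
    moreover have "0 < real c" "0 \<le> real c"
      using \<open>1 \<le> c\<close> by simp_all
    ultimately show "\<omega> \<in> ?L"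
      unfolding rooted_rough_isometric_def by blast
  qed
qed

section \<open>The two implications\<close>

definition segment_event :: "real \<Rightarrow> real \<Rightarrow> real \<Rightarrow> nat \<Rightarrow> 'w set" where
  "segment_event M D R n = {\<omega> \<in> space P. \<exists>m\<ge>1. rooted_rough_isometric_with M D R
     (real ` initial_segment (A \<omega>) n) 0 (real ` initial_segment (B \<omega>) m) 0}"

lemma sets_segment_event: "segment_event M D R n \<in> A.events"
  unfolding segment_event_def
  by (rule sets_initial_segments[OF A.pred_mem B.pred_mem,
        of "\<lambda>S S'. rooted_rough_isometric_with M D R (real ` S) 0 (real ` S') 0"])

lemma prob_partial_event_ge:
  assumes "1 \<le> c"
  shows "A.prob (segment_event c c c (Suc N)) \<le> A.prob (partial_event c N)"
proof (rule A.finite_measure_mono_AE[OF _ sets_partial_event[OF assms]])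
  show "AE \<omega> in P. \<omega> \<in> segment_event c c c (Suc N) \<longrightarrow> \<omega> \<in> partial_event c N"
    using A.AE_infinite B.AE_infinite
  proof eventually_elim
    fix \<omega> assume "infinite (A \<omega>)" "infinite (B \<omega>)"
    then show "\<omega> \<in> segment_event c c c (Suc N) \<longrightarrow> \<omega> \<in> partial_event c N"
      using partial_rough_isometry_of_initial_segments[of "A \<omega>" "B \<omega>" c _ N] assms A.root_mem[of \<omega>]
      unfolding segment_event_def partial_event_def by blast
  qed
qed

text \<open>One \<open>c\<close> replaces the constants for every \<open>n\<close>, and continuity
  from above along the decreasing events \<open>partial_event c N\<close> preserves the bound
  \<open>p\<close>.\<close>

lemma segment_events_imp_rough_isometric:
  assumes "0 < M" "\<And>n. 1 \<le> n \<Longrightarrow> p \<le> A.prob (segment_event M D R n)"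
  shows "p \<le> A.prob {\<omega> \<in> space P. rooted_rough_isometric (real ` A \<omega>) 0 (real ` B \<omega>) 0}"
proof -
  obtain c :: nat where c: "1 \<le> c" and
    mono: "\<And>(X :: real set) a (Y :: real set) b.
      rooted_rough_isometric_with M D R X a Y b \<Longrightarrow> rooted_rough_isometric_with c c c X a Y b"
    using rooted_rough_isometric_nat_constant[OF assms(1)] by metis
  have "p \<le> A.prob (partial_event c N)" for N
  proof -
    have "p \<le> A.prob (segment_event M D R (Suc N))"
      using assms(2) by simp
    also have "\<dots> \<le> A.prob (segment_event c c c (Suc N))"
      by (rule A.finite_measure_mono[OF _ sets_segment_event])
        (use mono in \<open>auto simp: segment_event_def\<close>)
    also have "\<dots> \<le> A.prob (partial_event c N)"
      using c by (rule prob_partial_event_ge)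
    finally show ?thesis .
  qed
  moreover have "(\<lambda>N. A.prob (partial_event c N)) \<longlonglongrightarrow> A.prob (\<Inter>N. partial_event c N)"
    using sets_partial_event[OF c] decseq_partial_event
    by (intro A.finite_Lim_measure_decseq) auto
  ultimately have "p \<le> A.prob (\<Inter>N. partial_event c N)"
    by (intro LIMSEQ_le_const) auto
  also have "\<dots> \<le> A.prob (\<Union>c\<in>{1..}. \<Inter>N. partial_event c N)"
    using c sets_Inter_partial_event
    by (intro A.finite_measure_mono sets.countable_UN'') auto
  finally show ?thesis
    unfolding rooted_rough_isometric_event .
qed

text \<open>A fixed \<open>c\<close> already works with positive probability; up to null sets, that
  event is covered by the segment event and a long-gap event of at most half its
  probability.\<close>

lemma rough_isometric_imp_segment_events:
  assumes "0 < A.prob {\<omega> \<in> space P. rooted_rough_isometric (real ` A \<omega>) 0 (real ` B \<omega>) 0}"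
  obtains p and c K :: nat where "0 < p" "1 \<le> c"
    "\<And>n. 1 \<le> n \<Longrightarrow> p \<le> A.prob (segment_event c c (2 * c + c * K) n)"
proof -
  define F where "F c = (\<Inter>N. partial_event c N)" for c
  have F_events: "F c \<in> A.events" if "1 \<le> c" for c
    unfolding F_def using that by (rule sets_Inter_partial_event)
  \<comment> \<open>Otherwise the whole event would be a countable union of null sets.\<close>
  have "\<exists>c\<ge>1. A.prob (F c) \<noteq> 0"
  proof (rule ccontr)
    assume "\<not> (\<exists>c\<ge>1. A.prob (F c) \<noteq> 0)"
    then have "(\<Union>c\<in>{1..}. F c) \<in> null_sets P"
      using F_events by (intro null_sets_UN') (auto simp: A.emeasure_eq_measure)
    then have "A.prob (\<Union>c\<in>{1..}. F c) = 0"
      by (simp add: A.emeasure_eq_measure null_sets_def)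
    with assms show False
      unfolding rooted_rough_isometric_event F_def by simp
  qed
  then obtain c where c: "1 \<le> c" and "A.prob (F c) \<noteq> 0"
    by blast
  define p where "p = A.prob (F c) / 2"
  have "0 < p"
    using \<open>A.prob (F c) \<noteq> 0\<close> by (simp add: p_def zero_less_measure_iff)
  have c2: "1 \<le> c\<^sup>2"
    using c by simp
  \<comment> \<open>A tail of a convergent series. It does not involve \<open>k\<close>, so one
    \<open>K\<close> serves all \<open>n\<close>.\<close>
  obtain K where K: "\<bar>\<Sum>i. (1 / 2 :: real) ^ ((i + K) div c\<^sup>2 - 4)\<bar> < p"
    using suminf_exist_split[OF \<open>0 < p\<close> summable_half_power_div[OF c2]] by auto
  have "p \<le> A.prob (segment_event c c (2 * c + c * K) n)" if n1: "1 \<le> n" for n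
  proof -
    obtain k where n: "n = Suc k"
      using n1 by (cases n) auto
    let ?E = "segment_event c c (2 * c + c * K) n" and ?G = "A.bad_gap (c\<^sup>2) K k"
    have "A.prob (F c) \<le> A.prob (?E \<union> ?G)"
    proof (rule A.finite_measure_mono_AE)
      show "AE \<omega> in P. \<omega> \<in> F c \<longrightarrow> \<omega> \<in> ?E \<union> ?G"
        using A.AE_infinite B.AE_infinite
      proof eventually_elim
        fix \<omega> assume inf: "infinite (A \<omega>)" "infinite (B \<omega>)"
        show "\<omega> \<in> F c \<longrightarrow> \<omega> \<in> ?E \<union> ?G"
        proof
          assume "\<omega> \<in> F c"
          then have \<omega>: "\<omega> \<in> space P" "rooted_rough_isometric_with c c c (real ` A \<omega>) 0 (real ` B \<omega>) 0"
            unfolding F_def Inter_partial_event[OF c] by auto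
          show "\<omega> \<in> ?E \<union> ?G"
          proof (cases "\<omega> \<in> ?G")
            case False
            then have "\<exists>m\<ge>1. rooted_rough_isometric_with c c (2 * c + c * K)
                (real ` initial_segment (A \<omega>) (Suc k)) 0 (real ` initial_segment (B \<omega>) m) 0"
              by (intro rough_isometric_initial_segments inf A.root_mem \<omega> c A.not_bad_gapD)
            with \<omega>(1) show ?thesis
              by (simp add: segment_event_def n)
          qed simp
        qed
      qed
      show "?E \<union> ?G \<in> A.events"
        by (intro sets.Un sets_segment_event A.bad_gap(1) c2)
    qed
    also have "\<dots> \<le> A.prob ?E + A.prob ?G"
      by (intro measure_Un_le sets_segment_event A.bad_gap(1) c2)
    also have "A.prob ?G \<le> p"
      using A.bad_gap(2)[OF c2, of K k] K by linarith
    finally show ?thesis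
      by (simp add: p_def)
  qed
  with \<open>0 < p\<close> c show thesis
    by (rule that)
qed

end

theorem theorem2p5:
  fixes P :: "'w measure" and A B :: "'w \<Rightarrow> nat set"
  assumes "rooted_bernoulli_percolation P A"
    and "rooted_bernoulli_percolation P B"
    and "indep_random_sets P A B"
  shows
    "measure P {\<omega> \<in> space P. rooted_rough_isometric (real ` A \<omega>) 0 (real ` B \<omega>) 0} > 0 \<longleftrightarrow>
     (\<exists>p>0. \<exists>M>0. \<exists>D\<ge>0. \<exists>R\<ge>0. \<forall>n\<ge>1.
        measure P {\<omega> \<in> space P. \<exists>m\<ge>1.
          rooted_rough_isometric_with M D R
            (real ` initial_segment (A \<omega>) n) 0 (real ` initial_segment (B \<omega>) m) 0} \<ge> p)"
proof -
  interpret prob_space P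
    using assms(1) by (simp add: rooted_bernoulli_percolation_def)
  interpret rooted_percolation_pair P A B
    by unfold_locales fact+
  show ?thesis
    unfolding segment_event_def[symmetric]
  proof
    assume "0 < prob {\<omega> \<in> space P. rooted_rough_isometric (real ` A \<omega>) 0 (real ` B \<omega>) 0}"
    then obtain p and c K :: nat where "0 < p" "1 \<le> c"
        "\<And>n. 1 \<le> n \<Longrightarrow> p \<le> prob (segment_event c c (2 * c + c * K) n)"
      using rough_isometric_imp_segment_events by blast
    then show "\<exists>p>0. \<exists>M>0. \<exists>D\<ge>0. \<exists>R\<ge>0. \<forall>n\<ge>1. p \<le> prob (segment_event M D R n)"
      by (intro exI[of _ p] exI[of _ "real c"] exI[of _ "real (2 * c + c * K)"] conjI allI impI) simp_all
  next
    assume "\<exists>p>0. \<exists>M>0. \<exists>D\<ge>0. \<exists>R\<ge>0. \<forall>n\<ge>1. p \<le> prob (segment_event M D R n)"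
    then obtain p M D R where "0 < p" "0 < M" "\<And>n. 1 \<le> n \<Longrightarrow> p \<le> prob (segment_event M D R n)"
      by blast
    then show "0 < prob {\<omega> \<in> space P. rooted_rough_isometric (real ` A \<omega>) 0 (real ` B \<omega>) 0}"
      using segment_events_imp_rough_isometric by fastforce
  qed
qed

end
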